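(* Let $(a_1,\dots,a_{24})$ be the vector \[ (1,4\beta,2\beta^{2},0,\beta^{4},2\beta^{5},-\beta^{6},0,-2\beta^{8},4\beta^{9},-\beta^{10},0,\beta^{12},-4\beta^{13},2\beta^{14},0,\beta^{16},-2\beta^{17},-\beta^{18},0,-2\beta^{20},-4\beta^{21},-\beta^{22},0). \] Then \[ \sum_{k=0}^\infty\frac{1}{\alpha^{24k}}\sum_{j=1}^{24}\frac{a_j}{24k+j}=0. \]
   Context: $\alpha=(1+\sqrt5)/2$ is the golden ratio and $\beta=-1/\alpha=(1-\sqrt5)/2$. *)

theory Defs
  imports "HOL-Analysis.Analysis"
begin

definition golden_alpha :: real  (\<open>\<alpha>\<close>) where
  "\<alpha> = (1 + sqrt 5) / 2"

definition golden_beta :: real  (\<open>\<beta>\<close>) where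
  "\<beta> = (1 - sqrt 5) / 2"

lemma golden_beta_eq: "\<beta> = - 1 / \<alpha>"
proof -
  have "1 + sqrt 5 > 0" by (simp add: add_pos_pos)
  then have "\<alpha> \<noteq> 0" by (simp add: golden_alpha_def)
  moreover have "\<beta> * \<alpha> = - 1"
    by (simp add: golden_alpha_def golden_beta_def field_simps)
  ultimately show ?thesis by (simp add: field_simps)
qed

definition coeffs_24 :: "real list" where
  "coeffs_24 =
    [1, 4 * \<beta>, 2 * \<beta>^2, 0, \<beta>^4, 2 * \<beta>^5, - (\<beta>^6), 0,
     - 2 * \<beta>^8, 4 * \<beta>^9, - (\<beta>^10), 0, \<beta>^12, - 4 * \<beta>^13, 2 * \<beta>^14, 0,
     \<beta>^16, - 2 * \<beta>^17, - (\<beta>^18), 0, - 2 * \<beta>^20, - 4 * \<beta>^21, - (\<beta>^22), 0]"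

text \<open>The coefficients are indexed from 1, whereas list positions start at 0.\<close>

definition a24 :: "nat \<Rightarrow> real" where
  "a24 j = coeffs_24 ! (j - 1)"

end

theory Submission
  imports Defs
begin

text \<open>
  Since \<open>1 / \<alpha>^24 = \<beta>^24\<close>, the sum is \<open>(1 / \<beta>) * (\<Sum>n. c n * \<beta>^n / n)\<close>
  for a sequence \<open>c\<close> of period 24, and splitting \<open>c\<close> shows that the sum over \<open>n\<close> is
  \<open>arctan \<beta> + 2 * arctan (\<beta>^2) + arctan (\<beta>^3) + arctan (\<beta>^6)\<close>.
  Because \<open>arctan x + arctan (x^3) = arctan (x / (1 - x^2))\<close>, this equals
  \<open>arctan (-1) + arctan (1 / sqrt 5) + arctan (\<beta>^2)\<close>, which vanishes by the addition
  theorem.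
\<close>

lemma arctan_sums:
  fixes x :: real
  assumes "\<bar>x\<bar> \<le> 1"
  shows "(\<lambda>k. (-1) ^ k * x ^ (2 * k + 1) / real (2 * k + 1)) sums arctan x"
  using sums_minus[OF sums_minus[OF summable_sums[OF summable_arctan_series[OF assms]]]]
    arctan_series[OF assms]
  by (simp add: field_simps)

text \<open>The block length \<open>N\<close> is even so that all blocks carry the same signs.\<close>

lemma arctan_power_sums_blocks:
  fixes x :: real
  assumes x: "\<bar>x\<bar> \<le> 1" and "d > 0" "N > 0" "even N"
  shows "(\<lambda>k. x ^ (2 * d * N * k) *
            (\<Sum>i<N. (-1) ^ i * real d * x ^ (d * (2 * i + 1)) / real (2 * d * N * k + d * (2 * i + 1))))
         sums arctan (x ^ d)"
proof -
  define f where "f = (\<lambda>m. (-1) ^ m * (x ^ d) ^ (2 * m + 1) / real (2 * m + 1))"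
  have "\<bar>x ^ d\<bar> \<le> 1"
    using x by (simp add: power_abs power_le_one)
  then have "f sums arctan (x ^ d)"
    unfolding f_def by (rule arctan_sums)
  then have "(\<lambda>k. sum f {k * N..<k * N + N}) sums arctan (x ^ d)"
    using \<open>N > 0\<close> by (rule sums_group)
  moreover have "sum f {k * N..<k * N + N} = x ^ (2 * d * N * k) *
      (\<Sum>i<N. (-1) ^ i * real d * x ^ (d * (2 * i + 1)) / real (2 * d * N * k + d * (2 * i + 1)))" for k
  proof -
    have "f (i + k * N) = x ^ (2 * d * N * k) *
      ((-1) ^ i * real d * x ^ (d * (2 * i + 1)) / real (2 * d * N * k + d * (2 * i + 1)))" for i
    proof -
      have sign: "(-1::real) ^ (i + k * N) = (-1) ^ i"
        using \<open>even N\<close> by (simp add: power_add)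
      have "d * (2 * (i + k * N) + 1) = 2 * d * N * k + d * (2 * i + 1)"
        by (simp add: algebra_simps)
      then have pow: "(x ^ d) ^ (2 * (i + k * N) + 1) = x ^ (2 * d * N * k) * x ^ (d * (2 * i + 1))"
        by (metis power_add power_mult)
      \<comment> \<open>Extending the fraction by \<open>d\<close> makes its denominator equal to
        the exponent of \<open>x\<close>, so series for different \<open>d\<close> share the
        denominators \<open>24 * k + j\<close> when \<open>2 * d * N = 24\<close>.\<close>
      have den: "real (2 * d * N * k + d * (2 * i + 1)) = real d * real (2 * (i + k * N) + 1)"
        by (simp add: algebra_simps)
      show ?thesis
        unfolding f_def sign pow den using \<open>d > 0\<close> by simp
    qed
    moreover have "sum f {k * N..<k * N + N} = (\<Sum>i<N. f (i + k * N))"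
      using sum.shift_bounds_nat_ivl[of f 0 "k * N" N] by (simp add: lessThan_atLeast0 add.commute)
    ultimately show ?thesis
      by (simp add: sum_distrib_left)
  qed
  ultimately show ?thesis
    by simp
qed

text \<open>The factor \<open>1 + x\<^sup>2\<close> of \<open>x + x ^ 3\<close> cancels against
  \<open>1 - x ^ 4\<close> in the addition theorem.\<close>

lemma arctan_add_arctan_cube:
  fixes x :: real
  assumes "\<bar>x\<bar> < 1"
  shows "arctan x + arctan (x ^ 3) = arctan (x / (1 - x\<^sup>2))"
proof -
  have "\<bar>x ^ 3\<bar> < 1"
    using assms by (simp add: power_abs power_less_one_iff)
  then have "arctan x + arctan (x ^ 3) = arctan ((x + x ^ 3) / (1 - x * x ^ 3))"
    using assms by (intro arctan_add) auto
  also have "(x + x ^ 3) / (1 - x * x ^ 3) = x * (1 + x\<^sup>2) / ((1 - x\<^sup>2) * (1 + x\<^sup>2))"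
    by (simp add: algebra_simps power_numeral_reduce)
  also have "\<dots> = x / (1 - x\<^sup>2)"
    using sum_power2_gt_zero_iff[of 1 x] by simp
  finally show ?thesis .
qed

lemma golden_beta_square: "\<beta>\<^sup>2 = \<beta> + 1"
  by (simp add: golden_beta_def power2_eq_square field_simps)

lemma golden_beta_bounds: "-1 < \<beta>" "\<beta> < 0"
  using real_sqrt_less_iff[of 5 9] real_sqrt_less_iff[of 1 5]
  by (simp_all add: golden_beta_def)

lemma arctan_golden_beta_relation:
  "arctan \<beta> + 2 * arctan (\<beta>\<^sup>2) + arctan (\<beta> ^ 3) + arctan (\<beta> ^ 6) = 0"
proof -
  have sq: "\<beta>\<^sup>2 = (3 - sqrt 5) / 2"
    by (simp add: golden_beta_square) (simp add: golden_beta_def field_simps)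
  have s5: "2 < sqrt 5" "sqrt 5 < 3"
    using real_sqrt_less_iff[of 4 5] real_sqrt_less_iff[of 5 9] by simp_all
  have s55: "sqrt 5 * sqrt 5 = 5"
    by simp
  \<comment> \<open>Here \<open>1 - \<beta>\<^sup>2 = - \<beta>\<close>, so the quotient is
    \<open>-1\<close>.\<close>
  have "arctan \<beta> + arctan (\<beta> ^ 3) = arctan (-1)"
    using arctan_add_arctan_cube[of \<beta>] golden_beta_bounds by (simp add: golden_beta_square)
  moreover have "arctan (\<beta>\<^sup>2) + arctan (\<beta> ^ 6) = arctan (1 / sqrt 5)"
  proof -
    have "\<beta>\<^sup>2 / (1 - (\<beta>\<^sup>2)\<^sup>2) = 1 / sqrt 5"
    proof -
      \<comment> \<open>Divided by \<open>\<beta>\<^sup>2\<close>, this is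
        \<open>\<alpha>\<^sup>2 - \<beta>\<^sup>2 = sqrt 5\<close>.\<close>
      have "1 - (\<beta>\<^sup>2)\<^sup>2 = \<beta>\<^sup>2 * sqrt 5"
        unfolding sq using s55 by (simp add: power2_eq_square field_simps)
      moreover have "\<beta>\<^sup>2 \<noteq> 0"
        using golden_beta_bounds by simp
      ultimately show ?thesis by simp
    qed
    moreover have "\<bar>\<beta>\<^sup>2\<bar> < 1"
      using s5 unfolding sq by simp
    ultimately show ?thesis
      using arctan_add_arctan_cube[of "\<beta>\<^sup>2"] by (simp flip: power_mult)
  qed
  moreover have "arctan (1 / sqrt 5) + arctan (\<beta>\<^sup>2) = arctan 1"
  proof -
    have "arctan (1 / sqrt 5) + arctan (\<beta>\<^sup>2)
        = arctan ((1 / sqrt 5 + \<beta>\<^sup>2) / (1 - 1 / sqrt 5 * \<beta>\<^sup>2))"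
      using s5 unfolding sq by (intro arctan_add) auto
    \<comment> \<open>Numerator and denominator both equal
      \<open>(3 * sqrt 5 - 3) / (2 * sqrt 5)\<close>.\<close>
    also have "(1 / sqrt 5 + \<beta>\<^sup>2) / (1 - 1 / sqrt 5 * \<beta>\<^sup>2) = 1"
      using s5 s55 unfolding sq by (simp add: field_simps)
    finally show ?thesis .
  qed
  ultimately show ?thesis
    by (simp add: arctan_minus)
qed

theorem theorem4p5:
  shows "(\<lambda>k::nat. 1 / \<alpha> ^ (24 * k) * (\<Sum>j = 1..24. a24 j / real (24 * k + j))) sums 0"
proof -
  \<comment> \<open>Up to the factor \<open>\<beta> ^ (24 * k)\<close>, this is block
    \<open>k\<close> of the series for \<open>arctan (\<beta> ^ d)\<close>. The values
    \<open>d\<close> = 1, 2, 3, 6 all leave an even \<open>N = 12 / d\<close>.\<close>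
  define S where "S = (\<lambda>d N k. \<Sum>i<N. (-1) ^ i * real d *
    \<beta> ^ (d * (2 * i + 1)) / real (24 * k + d * (2 * i + 1)))"
  have S: "(\<lambda>k. \<beta> ^ (24 * k) * S d N k) sums arctan (\<beta> ^ d)"
    if "d > 0" "N > 0" "even N" and dN: "2 * d * N = 24" for d N
    using arctan_power_sums_blocks[of \<beta> d N] golden_beta_bounds that(1-3)
    unfolding dN S_def by simp
  have "(\<lambda>k. (\<beta> ^ (24 * k) * S 1 12 k + 2 * (\<beta> ^ (24 * k) * S 2 6 k)
        + \<beta> ^ (24 * k) * S 3 4 k + \<beta> ^ (24 * k) * S 6 2 k) / \<beta>)
      sums ((arctan (\<beta> ^ 1) + 2 * arctan (\<beta>\<^sup>2) + arctan (\<beta> ^ 3) + arctan (\<beta> ^ 6)) / \<beta>)"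
    by (intro sums_divide sums_add sums_mult S) auto
  moreover have "1 / \<alpha> ^ (24 * k) * (\<Sum>j = 1..24. a24 j / real (24 * k + j))
      = (\<beta> ^ (24 * k) * S 1 12 k + 2 * (\<beta> ^ (24 * k) * S 2 6 k)
        + \<beta> ^ (24 * k) * S 3 4 k + \<beta> ^ (24 * k) * S 6 2 k) / \<beta>" for k
  proof -
    define A where "A = (\<Sum>j = 1..24. a24 j / real (24 * k + j))"
    \<comment> \<open>The factor \<open>\<beta>\<close> is needed because \<open>a24 j\<close>
      carries \<open>\<beta> ^ (j - 1)\<close>, while the arctan series have
      \<open>\<beta> ^ j\<close> over \<open>24 * k + j\<close>.\<close>
    have "\<beta> * A = S 1 12 k + 2 * S 2 6 k + S 3 4 k + S 6 2 k"
    proof -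
      \<comment> \<open>With the reciprocals as opaque atoms \<open>r n\<close>, the claim becomes a
        polynomial identity, checked by comparing the coefficients of each
        \<open>r n\<close>.\<close>
      define r where "r = (\<lambda>n. inverse (real (24 * k + n)))"
      have r: "t / real (24 * k + n) = t * r n" for t n
        by (simp add: r_def divide_inverse)
      have shift: "(\<Sum>j = 1..24. a24 j * r j) = (\<Sum>i<24. coeffs_24 ! i * r (i + 1))"
        using sum.atLeast1_atMost_eq[of "\<lambda>j. a24 j * r j" 24] by (simp add: a24_def)
      show ?thesis
        unfolding A_def S_def r shift
        by (simp add: coeffs_24_def lessThan_nat_numeral lessThan_Suc flip: numeral_2_eq_2)
          (simp add: algebra_simps power_numeral_reduce)
    qed
    moreover have "\<beta> \<noteq> 0"
      using golden_beta_bounds by simp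
    ultimately have "A = (S 1 12 k + 2 * S 2 6 k + S 3 4 k + S 6 2 k) / \<beta>"
      by (simp add: nonzero_eq_divide_eq mult.commute)
    \<comment> \<open>The sign in \<open>\<beta> = - 1 / \<alpha>\<close> disappears since the
      exponent is even.\<close>
    moreover have "1 / \<alpha> ^ (24 * k) = \<beta> ^ (24 * k)"
      by (simp add: golden_beta_eq power_divide)
    ultimately show ?thesis
      unfolding A_def[symmetric] by (simp add: algebra_simps)
  qed
  ultimately show ?thesis
    using arctan_golden_beta_relation by simp
qed

end
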